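(* Let $n\ge 4$, and let $L$ be a subword-free language over a finite alphabet $\Sigma$ with $\kappa(L)=n$. Then $\kappa(L^R)\le 2^{n-3}+2$, where $L^R=\{w^R\mid w\in L\}$ is the reverse of $L$. The bound is tight if $|\Sigma|\ge 2^{n-3}-1$: for every $n\ge4$ and every finite alphabet $\Sigma$ with $|\Sigma|\ge 2^{n-3}-1$ there is a subword-free language $L$ over $\Sigma$ with $\kappa(L)=n$ and $\kappa(L^R)=2^{n-3}+2$. The bound cannot be met for smaller alphabets: if $|\Sigma|<2^{n-3}-1$, then $\kappa(L^R)<2^{n-3}+2$ for every subword-free language $L$ over $\Sigma$ with $\kappa(L)=n$. Finally, the bound cannot be met if $L$ contains a word of length at least $3$: in that case $\kappa(L^R)<2^{n-3}+2$.
   Context: For a language $L\subseteq\Sigma^*$ over a finite non-empty alphabet $\Sigma$ and a word $w\in\Sigma^*$, the (left) quotient of $L$ by $w$ is $L_w=\{x\in\Sigma^*\mid wx\in L\}$. The quotient complexity $\kappa(L)$ of a regular language $L$ is the number of distinct quotients $L_w$, $w\in\Sigma^*$; it equals the number of states of the minimal complete deterministic finite automaton accepting $L$ over $\Sigma$. The reverse $w^R$ of a word $w$ is $w$ written backwards. A word $v$ is a subword of $w$ if it is a (not necessarily contiguous) subsequence of $w$. A language $L$ is subword-free if, whenever $u,v\in L$ and $u$ is a subword of $v$, then $u=v$. (Every subword-free language is finite, hence regular.) *)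

theory Defs
  imports Main "HOL-Library.Sublist"
begin

text \<open>
  The alphabet is an explicit carrier \<open>\<Sigma>\<close>, and \<open>lists \<Sigma>\<close> is the set of all words over it.
\<close>

definition left_quotient :: "'a set \<Rightarrow> 'a list set \<Rightarrow> 'a list \<Rightarrow> 'a list set" where
  "left_quotient \<Sigma> L w = {x \<in> lists \<Sigma>. w @ x \<in> L}"

definition quotients :: "'a set \<Rightarrow> 'a list set \<Rightarrow> 'a list set set" where
  "quotients \<Sigma> L = left_quotient \<Sigma> L ` lists \<Sigma>"

text \<open>
  Since \<open>card\<close> is 0 on infinite sets, the following is the intended number only when \<open>L\<close> is
  regular, i.e. has finitely many quotients. A positive value implies this, and by
  \<open>finite_quotients_rev\<close> below it then also holds for the reverse of \<open>L\<close>.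
\<close>

definition quotient_complexity :: "'a set \<Rightarrow> 'a list set \<Rightarrow> nat" where
  "quotient_complexity \<Sigma> L = card (quotients \<Sigma> L)"

definition subword_free :: "'a list set \<Rightarrow> bool" where
  "subword_free L \<longleftrightarrow> (\<forall>u\<in>L. \<forall>v\<in>L. subseq u v \<longrightarrow> u = v)"

lemma finite_quotients_rev:
  assumes "finite (quotients \<Sigma> L)"
  shows "finite (quotients \<Sigma> (rev ` L))"
proof -
  define g where
    "g = (\<lambda>C. {x \<in> lists \<Sigma>. left_quotient \<Sigma> L (rev x) \<in> C})"
  have "left_quotient \<Sigma> (rev ` L) w = g {Q \<in> quotients \<Sigma> L. rev w \<in> Q}"
    if w: "w \<in> lists \<Sigma>" for w
  proof -
    have "w @ x \<in> rev ` L \<longleftrightarrow> rev x @ rev w \<in> L" for x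
      by (metis image_iff rev_append rev_rev_ident)
    then show ?thesis
      using w by (auto simp: g_def left_quotient_def quotients_def in_lists_conv_set)
  qed
  then have "quotients \<Sigma> (rev ` L) \<subseteq> g ` Pow (quotients \<Sigma> L)"
    by (auto simp: quotients_def[of \<Sigma> "rev ` L"])
  with assms show ?thesis
    by (meson finite_Pow_iff finite_imageI finite_subset)
qed

end

theory Submission
  imports Defs
begin

text \<open>
  Among the quotients of a subword-free language \<open>L\<close> are \<open>L\<close>, \<open>{\<epsilon>}\<close> and \<open>\<emptyset>\<close>; call the other
  \<open>m = n - 3\<close> intermediate. The quotient of the reverse of \<open>L\<close> by \<open>w\<^sup>R\<close> is the reverse of \<open>L\<close> if
  \<open>w = \<epsilon>\<close>, it is \<open>{\<epsilon>}\<close> if \<open>w \<in> L\<close>, and otherwise it is determined by the set of intermediate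
  quotients containing \<open>w\<close>, which gives at most \<open>2 ^ m + 2\<close> quotients.

  If the bound is met, every set of intermediate quotients arises in this way; in particular some
  \<open>w\<close> lies in all of them. Then no letter \<open>a\<close> leads from an intermediate quotient \<open>L\<^sub>u\<close> to an
  intermediate one, as otherwise \<open>uw\<close> and \<open>uaw\<close> would both be in \<open>L\<close>. So words of \<open>L\<close> have length at
  most 2, the words realizing nonempty sets are letters, and there are \<open>2 ^ m - 1\<close> of them.
  Conversely, the language of the two-letter words \<open>a\<^sub>i b\<^sub>S\<close>, for \<open>i \<in> S \<subseteq> {0..<m}\<close>, meets the bound.
\<close>

section \<open>Quotients of a subword-free language\<close>

lemma left_quotient_iff:
  "w @ x \<in> L \<longleftrightarrow> x \<in> left_quotient \<Sigma> L w" if "L \<subseteq> lists \<Sigma>"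
  using that by (auto simp: left_quotient_def)

text \<open>Having at least four quotients rules out the degenerate languages \<open>{}\<close> and
  \<open>{[]}\<close>; a positive \<open>card\<close> also carries finiteness.\<close>

locale subword_free_language =
  fixes \<Sigma> :: "'a set" and L :: "'a list set"
  assumes words: "L \<subseteq> lists \<Sigma>"
    and sf: "subword_free L"
    and card_ge_4: "4 \<le> card (quotients \<Sigma> L)"
    and alphabet_nonempty: "\<Sigma> \<noteq> {}"
begin

lemma subword_eq: "u \<in> L \<Longrightarrow> v \<in> L \<Longrightarrow> subseq u v \<Longrightarrow> u = v"
  using sf by (auto simp: subword_free_def)

lemma finite_quotients: "finite (quotients \<Sigma> L)"
  using card_ge_4 card.infinite by fastforce

lemma left_quotient_Nil: "left_quotient \<Sigma> L [] = L"
  using words by (auto simp: left_quotient_def)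

text \<open>\<open>x\<close> is a prefix, hence a subword, of every \<open>x @ y\<close>, so
  freeness leaves only \<open>y = []\<close>.\<close>

lemma left_quotient_mem:
  assumes "x \<in> L"
  shows "left_quotient \<Sigma> L x = {[]}"
proof -
  have "y = []" if "x @ y \<in> L" for y
    using subword_eq[OF assms that list_emb_prefix[OF subseq_order.order_refl]] by simp
  then show ?thesis using assms by (auto simp: left_quotient_def)
qed

lemma nonempty: "L \<noteq> {}"
proof
  assume "L = {}"
  then have "quotients \<Sigma> L \<subseteq> {{}}" by (auto simp: quotients_def left_quotient_def)
  then have "card (quotients \<Sigma> L) \<le> card {{} :: 'a list set}" by (intro card_mono) auto
  then show False using card_ge_4 by simp
qed

text \<open>The empty word is a subword of every word, so it would be the only word of
  \<open>L\<close>, leaving at most two quotients.\<close>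

lemma Nil_notin: "[] \<notin> L"
proof
  assume "[] \<in> L"
  then have L: "L = {[]}" using subword_eq[of "[]"] by blast
  then have "quotients \<Sigma> L \<subseteq> {{}, {[]}}" by (auto simp: quotients_def left_quotient_def)
  then have "card (quotients \<Sigma> L) \<le> card {{}, {[] :: 'a list}}" by (intro card_mono) auto
  then show False using card_ge_4 by (auto simp: card_insert_if split: if_splits)
qed

definition intermediate :: "'a list set set" where
  "intermediate = quotients \<Sigma> L - {L, {[]}, {}}"

lemma finite_intermediate: "finite intermediate"
  using finite_quotients by (simp add: intermediate_def)

text \<open>The three discarded sets are distinct and all occur as quotients: by \<open>[]\<close>,
  by a word of \<open>L\<close>, and by such a word followed by a letter.\<close>

lemma card_intermediate: "card intermediate = card (quotients \<Sigma> L) - 3"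
proof -
  obtain x where x: "x \<in> L" using nonempty by blast
  obtain a where a: "a \<in> \<Sigma>" using alphabet_nonempty by blast
  have "L \<in> quotients \<Sigma> L" unfolding quotients_def
    using left_quotient_Nil by (metis imageI lists.Nil)
  moreover have "{[]} \<in> quotients \<Sigma> L" unfolding quotients_def
    using left_quotient_mem[OF x] x words by (metis imageI subsetD)
  moreover have "x @ a # y \<notin> L" for y
    using subword_eq[OF x _ list_emb_prefix[OF subseq_order.order_refl], of "a # y"] by auto
  then have "left_quotient \<Sigma> L (x @ [a]) = {}"
    by (simp add: left_quotient_def)
  then have "{} \<in> quotients \<Sigma> L" unfolding quotients_def
    using x words a by (metis imageI append_in_lists_conv lists.Cons lists.Nil subsetD)
  moreover have "L \<noteq> {[]}" using Nil_notin by auto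
  then have "card {L, {[]}, {}} = 3" using nonempty by simp
  ultimately show ?thesis
    unfolding intermediate_def by (subst card_Diff_subset) auto
qed

section \<open>Quotients of the reverse and the upper bound\<close>

definition containing :: "'a list \<Rightarrow> 'a list set set" where
  "containing w = {Q \<in> intermediate. w \<in> Q}"

lemma left_quotient_rev:
  "left_quotient \<Sigma> (rev ` L) (rev w) = {x \<in> lists \<Sigma>. w \<in> left_quotient \<Sigma> L (rev x)}"
proof -
  have "rev w @ x \<in> rev ` L \<longleftrightarrow> rev x @ w \<in> L" for x
    by (metis image_iff rev_append rev_rev_ident)
  then show ?thesis
    by (simp add: left_quotient_def[of \<Sigma> "rev ` L"] left_quotient_iff[OF words])
qed

text \<open>Mirror image of \<open>left_quotient_mem\<close>, with suffixes in place of
  prefixes.\<close>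

lemma left_quotient_rev_mem:
  assumes "w \<in> L"
  shows "left_quotient \<Sigma> (rev ` L) (rev w) = {[]}"
proof -
  have "x = []" if "rev x @ w \<in> L" for x
    using subword_eq[OF assms that list_emb_append2[OF subseq_order.order_refl]] by simp
  then show ?thesis unfolding left_quotient_rev
    using assms by (auto simp: left_quotient_iff[OF words, symmetric])
qed

text \<open>None of \<open>L\<close>, \<open>{[]}\<close> and \<open>{}\<close> can contain such a
  \<open>w\<close>, so the intermediate quotients alone decide membership.\<close>

lemma left_quotient_rev_containing:
  assumes "w \<noteq> []" "w \<notin> L"
  shows "left_quotient \<Sigma> (rev ` L) (rev w) =
    {x \<in> lists \<Sigma>. left_quotient \<Sigma> L (rev x) \<in> containing w}"
  unfolding left_quotient_rev containing_def intermediate_def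
  using assms by (auto simp: quotients_def in_lists_conv_set)

text \<open>The empty word and the words of \<open>L\<close> are left out because they contribute
  only the reverse of \<open>L\<close> and \<open>{[]}\<close>, which are counted
  separately.\<close>

definition realized :: "'a list set set set" where
  "realized = containing ` {w \<in> lists \<Sigma>. w \<noteq> [] \<and> w \<notin> L}"

lemma realized_subset: "realized \<subseteq> Pow intermediate"
  by (auto simp: realized_def containing_def)

lemma card_quotients_rev_le: "card (quotients \<Sigma> (rev ` L)) \<le> card realized + 2"
proof -
  let ?g = "\<lambda>C. {x \<in> lists \<Sigma>. left_quotient \<Sigma> L (rev x) \<in> C}"
  have fin: "finite realized"
    using realized_subset finite_intermediate by (meson finite_Pow_iff finite_subset)
  have "left_quotient \<Sigma> (rev ` L) v \<in> {rev ` L, {[]}} \<union> ?g ` realized"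
    if v: "v \<in> lists \<Sigma>" for v
  proof -
    define w where "w = rev v"
    have vw: "v = rev w" and w: "w \<in> lists \<Sigma>"
      using v by (auto simp: w_def in_lists_conv_set)
    consider "w = []" | "w \<in> L" | "w \<noteq> []" "w \<notin> L" by blast
    then show ?thesis
    proof cases
      case 1
      then have "left_quotient \<Sigma> (rev ` L) v = rev ` L"
        using words vw by (auto simp: left_quotient_def in_lists_conv_set)
      then show ?thesis by simp
    next
      case 2
      then show ?thesis using left_quotient_rev_mem vw by simp
    next
      case 3
      then have "containing w \<in> realized" using w by (auto simp: realized_def)
      then show ?thesis using left_quotient_rev_containing[OF 3] vw by blast
    qed
  qed
  then have "quotients \<Sigma> (rev ` L) \<subseteq> {rev ` L, {[]}} \<union> ?g ` realized"
    by (auto simp: quotients_def)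
  then have "card (quotients \<Sigma> (rev ` L)) \<le> card ({rev ` L, {[]}} \<union> ?g ` realized)"
    using fin by (intro card_mono) auto
  also have "\<dots> \<le> card {rev ` L, {[]}} + card (?g ` realized)" by (rule card_Un_le)
  also have "\<dots> \<le> 2 + card realized"
    using card_image_le[OF fin] by (intro add_mono) (auto simp: card_insert_if)
  finally show ?thesis by simp
qed

lemma card_quotients_rev_bound:
  "card (quotients \<Sigma> (rev ` L)) \<le> 2 ^ (card (quotients \<Sigma> L) - 3) + 2"
proof -
  have "card realized \<le> card (Pow intermediate)"
    using realized_subset finite_intermediate by (intro card_mono) auto
  then show ?thesis
    using card_quotients_rev_le by (simp add: card_Pow finite_intermediate card_intermediate)
qed

section \<open>Languages meeting the bound\<close>

context
  assumes bound_met: "2 ^ (card (quotients \<Sigma> L) - 3) + 2 \<le> card (quotients \<Sigma> (rev ` L))"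
begin

text \<open>Besides the two separately counted quotients, the bound asks for as many realized sets
  as there are sets of intermediate quotients, so none is missing.\<close>

lemma realized_eq: "realized = Pow intermediate"
proof (rule card_seteq)
  show "card (Pow intermediate) \<le> card realized"
    using bound_met card_quotients_rev_le
    by (simp add: card_Pow finite_intermediate card_intermediate)
qed (use realized_subset finite_intermediate in auto)

text \<open>Length three leaves two nonempty proper prefixes, \<open>[a]\<close> and
  \<open>[a, b]\<close>, with intermediate quotients; a \<open>w\<close> common to both contradicts
  freeness.\<close>

lemma length_le_2:
  assumes "x \<in> L"
  shows "length x \<le> 2"
proof (rule ccontr)
  assume "\<not> length x \<le> 2"
  then have "Suc (Suc (Suc 0)) \<le> length x" by simp
  then obtain a b c y where x: "x = a # b # c # y"
    by (auto simp: Suc_le_length_iff)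
  have ab: "a \<in> \<Sigma>" "b \<in> \<Sigma>" using assms words x by auto
  have "intermediate \<in> realized" by (simp add: realized_eq)
  then obtain w where w: "containing w = intermediate"
    unfolding realized_def by blast
  \<comment> \<open>The rest \<open>z\<close> lies in the quotient by \<open>u\<close>. It is
    neither empty nor, as a proper suffix of \<open>x\<close>, in \<open>L\<close>, so this quotient
    is none of the three exceptions.\<close>
  have inter: "left_quotient \<Sigma> L u \<in> intermediate"
    if "u \<noteq> []" "u \<in> lists \<Sigma>" "u @ z = x" "z \<noteq> []" for u z
  proof -
    have z: "z \<in> left_quotient \<Sigma> L u"
      using that assms left_quotient_iff[OF words] by blast
    moreover have "z \<notin> L"
    proof
      assume "z \<in> L"
      then have "z = x" using subword_eq[of z x] assms that(3) by auto
      then show False using that by simp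
    qed
    ultimately show ?thesis using that by (auto simp: intermediate_def quotients_def)
  qed
  have "w \<in> left_quotient \<Sigma> L [a]" "w \<in> left_quotient \<Sigma> L [a, b]"
    using inter[of "[a]" "b # c # y"] inter[of "[a, b]" "c # y"] w x ab
    by (auto simp: containing_def)
  then have "[a] @ w \<in> L" "[a, b] @ w \<in> L" by (auto simp: left_quotient_def)
  then have "[a] @ w = [a, b] @ w" by (rule subword_eq) auto
  then show False by (metis append_Cons append_Nil list.inject not_Cons_self2)
qed

text \<open>Every nonempty set of intermediate quotients must be realized by a single letter, and
  one letter realizes only one set. The empty set is excluded since longer words may realize
  it.\<close>

lemma card_alphabet_ge:
  assumes "finite \<Sigma>"
  shows "2 ^ (card (quotients \<Sigma> L) - 3) - 1 \<le> card \<Sigma>"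
proof -
  have "T \<in> (\<lambda>a. containing [a]) ` \<Sigma>" if T: "T \<in> Pow intermediate - {{}}" for T
  proof -
    obtain w where w: "w \<in> lists \<Sigma>" "w \<noteq> []" "T = containing w"
      using T by (auto simp flip: realized_eq simp: realized_def)
    \<comment> \<open>As \<open>T\<close> is nonempty, \<open>w\<close> completes some nonempty
      \<open>u\<close> to a word of \<open>L\<close>, whose length is at most 2; hence
      \<open>w\<close> is one letter.\<close>
    then obtain Q where Q: "Q \<in> intermediate" "w \<in> Q" using T by (auto simp: containing_def)
    then obtain u where u: "Q = left_quotient \<Sigma> L u" "u \<noteq> []"
      using left_quotient_Nil by (auto simp: intermediate_def quotients_def)
    then have "length (u @ w) \<le> 2"
      using Q(2) by (intro length_le_2) (simp add: left_quotient_def)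
    moreover have "length u \<ge> 1" "length w \<ge> 1"
      using u w by (simp_all add: Suc_le_eq)
    ultimately have "length w = 1" by simp
    then obtain a where "w = [a]" by (auto simp: length_Suc_conv)
    then show ?thesis using w by auto
  qed
  then have "card (Pow intermediate - {{}}) \<le> card ((\<lambda>a. containing [a]) ` \<Sigma>)"
    using assms by (intro card_mono) auto
  also have "\<dots> \<le> card \<Sigma>" using assms by (rule card_image_le)
  finally show ?thesis
    by (simp add: card_Diff_singleton card_Pow finite_intermediate card_intermediate)
qed

end

end

section \<open>Languages of two-letter words and the witness\<close>

lemma card_quotients_two_letter_words:
  fixes E :: "('a \<times> 'a) set"
  assumes E: "E \<subseteq> \<Sigma> \<times> \<Sigma>" "E \<noteq> {}" "finite E"
  defines "L \<equiv> (\<lambda>(x, y). [x, y]) ` E"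
  shows "card (quotients \<Sigma> L) = card ((\<lambda>x. E `` {x}) ` Domain E) + 3"
proof -
  \<comment> \<open>With \<open>E\<close> read as a directed graph, the quotients by one letter are
    the successor sets, written as words by \<open>?h\<close>; \<open>?R\<close> collects the
    nonempty ones.\<close>
  let ?h = "\<lambda>A. (\<lambda>y. [y]) ` A"
  let ?R = "(\<lambda>x. E `` {x}) ` Domain E"
  obtain x y where xy: "(x, y) \<in> E" using E by auto
  have xyS: "x \<in> \<Sigma>" "y \<in> \<Sigma>" using xy E by auto
  have memL: "w \<in> L \<longleftrightarrow> (\<exists>a b. w = [a, b] \<and> (a, b) \<in> E)" for w
    by (force simp: L_def)
  have "L \<subseteq> lists \<Sigma>" using E by (auto simp: L_def)
  then have q0: "left_quotient \<Sigma> L [] = L"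
    by (auto simp: left_quotient_def)
  have q1: "left_quotient \<Sigma> L [a] = ?h (E `` {a})" for a
    using E by (auto simp: left_quotient_def memL)
  have q2: "left_quotient \<Sigma> L [a, b] = (if (a, b) \<in> E then {[]} else {})" for a b
    by (auto simp: left_quotient_def memL)
  have q3: "left_quotient \<Sigma> L (a # b # c # w) = {}" for a b c w
    by (auto simp: left_quotient_def memL)
  have all: "left_quotient \<Sigma> L w \<in> {L, {[]}, {}} \<union> ?h ` ?R" for w
  proof -
    consider "w = []" | a where "w = [a]" "a \<in> Domain E" | a where "w = [a]" "a \<notin> Domain E"
      | a b where "w = [a, b]" | a b c v where "w = a # b # c # v"
      by (metis list.exhaust)
    then show ?thesis
    proof cases
      case 3
      then have "E `` {a} = {}" by auto
      then show ?thesis using 3 by (simp add: q1)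
    qed (auto simp: q0 q1 q2 q3)
  qed
  have "quotients \<Sigma> L \<subseteq> {L, {[]}, {}} \<union> ?h ` ?R"
    unfolding quotients_def using all by blast
  moreover have "L \<in> quotients \<Sigma> L"
    unfolding quotients_def using q0 by (metis imageI lists.Nil)
  moreover have "{[]} \<in> quotients \<Sigma> L"
    unfolding quotients_def using q2[of x y] xy xyS
    by (intro image_eqI[of _ _ "[x, y]"]) auto
  moreover have "{} \<in> quotients \<Sigma> L"
    unfolding quotients_def using xyS q3[of x y x "[]"]
    by (intro image_eqI[of _ _ "[x, y, x]"]) auto
  moreover have "?h ` ?R \<subseteq> quotients \<Sigma> L"
  proof clarify
    fix a b assume "(a, b) \<in> E"
    then have "[a] \<in> lists \<Sigma>" using E by auto
    then show "?h (E `` {a}) \<in> quotients \<Sigma> L"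
      unfolding quotients_def q1[symmetric] by (rule imageI)
  qed
  ultimately have "quotients \<Sigma> L = {L, {[]}, {}} \<union> ?h ` ?R"
    by blast
  moreover have "finite ?R" using E by (auto intro: finite_Domain)
  \<comment> \<open>A nonempty successor set gives a word of length exactly one, which separates it
    from the other three quotients.\<close>
  moreover have "{L, {[]}, {}} \<inter> ?h ` ?R = {}"
  proof -
    have "?h (E `` {a}) \<noteq> L" "?h (E `` {a}) \<noteq> {[]}" "?h (E `` {a}) \<noteq> {}"
      if "(a, b) \<in> E" for a b
    proof -
      have "[b] \<in> ?h (E `` {a})" "[b] \<notin> L" "[b] \<notin> {[]}" using that by (auto simp: memL)
      then show "?h (E `` {a}) \<noteq> L" "?h (E `` {a}) \<noteq> {[]}" "?h (E `` {a}) \<noteq> {}"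
        by blast+
    qed
    then show ?thesis by blast
  qed
  moreover have "card {L, {[]}, {}} = 3"
  proof -
    have "[x, y] \<in> L" "[] \<notin> L" using xy by (auto simp: memL)
    then have "L \<noteq> {[]}" "L \<noteq> {}" by auto
    then show ?thesis by simp
  qed
  moreover have "card (?h ` ?R) = card ?R"
    by (intro card_image inj_onI) (simp add: inj_image_eq_iff inj_def)
  ultimately show ?thesis by (simp add: card_Un_disjoint del: insert_disjoint Un_insert_left)
qed

lemma subword_free_length:
  assumes "\<And>w. w \<in> L \<Longrightarrow> length w = k"
  shows "subword_free L"
  using assms by (auto simp: subword_free_def subseq_same_length)

lemma bound_attained:
  fixes \<Sigma> :: "'a set"
  assumes "finite \<Sigma>" and m: "1 \<le> m" and card: "2 ^ m - 1 \<le> card \<Sigma>"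
  obtains L where "L \<subseteq> lists \<Sigma>" "subword_free L" "card (quotients \<Sigma> L) = m + 3"
    "card (quotients \<Sigma> (rev ` L)) = 2 ^ m + 2"
proof -
  define N where "N = {..<m}"
  let ?P = "Pow N - {{}}"
  have cP: "card ?P = 2 ^ m - 1" by (simp add: N_def card_Diff_singleton card_Pow)
  have finP: "finite ?P" by (simp add: N_def)
  \<comment> \<open>One letter is chosen per nonempty subset of \<open>N\<close>. Any further letter
    occurs in no word of \<open>L\<close> and leads only to the empty quotient, which is counted
    anyway.\<close>
  obtain f where f: "f ` ?P \<subseteq> \<Sigma>" "inj_on f ?P"
    using card_le_inj[OF finP \<open>finite \<Sigma>\<close>] card cP by auto
  \<comment> \<open>The letter \<open>f {i}\<close> serves both as first letter for \<open>i\<close>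
    and as second letter for the singleton \<open>{i}\<close>; this sharing keeps the alphabet down
    to \<open>2 ^ m - 1\<close> letters.\<close>
  define E where "E = (\<lambda>(i, S). (f {i}, f S)) ` (SIGMA i:N. {S. S \<subseteq> N \<and> i \<in> S})"
  define L where "L = (\<lambda>(x, y). [x, y]) ` E"
  have feq: "f S = f T \<longleftrightarrow> S = T" if "S \<in> ?P" "T \<in> ?P" for S T
    using f(2) that by (auto dest: inj_onD)
  have memE: "(f S, f T) \<in> E \<longleftrightarrow> (\<exists>i\<in>T. S = {i})" if "S \<in> ?P" "T \<in> ?P" for S T
  proof
    assume "(f S, f T) \<in> E"
    then obtain i U where i: "i \<in> N" "U \<subseteq> N" "i \<in> U" "f S = f {i}" "f T = f U"
      by (auto simp: E_def)
    then have "S = {i}" "T = U" using feq[of S "{i}"] feq[of T U] that by auto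
    then show "\<exists>i\<in>T. S = {i}" using i by auto
  next
    assume "\<exists>i\<in>T. S = {i}"
    then show "(f S, f T) \<in> E" using that by (force simp: E_def)
  qed
  have EP: "E \<subseteq> f ` ?P \<times> f ` ?P" by (auto simp: E_def)
  have ES: "E \<subseteq> \<Sigma> \<times> \<Sigma>" using EP f(1) by blast
  have finE: "finite E" using EP finP by (meson finite_SigmaI finite_imageI finite_subset)
  have "0 \<in> N" using m by (simp add: N_def)
  then have "(f {0}, f {0}) \<in> E" using memE[of "{0}" "{0}"] by simp
  then have nE: "E \<noteq> {}" by blast
  have rows: "E `` {f {i}} = f ` {S. S \<subseteq> N \<and> i \<in> S}" if "i \<in> N" for i
  proof -
    have i: "{i} \<in> ?P" using that by simp
    show ?thesis
    proof (intro equalityI subsetI)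
      fix y assume y: "y \<in> E `` {f {i}}"
      then obtain T where "T \<in> ?P" "y = f T" using EP by blast
      then show "y \<in> f ` {S. S \<subseteq> N \<and> i \<in> S}" using memE[OF i, of T] y by auto
    next
      fix y assume "y \<in> f ` {S. S \<subseteq> N \<and> i \<in> S}"
      then obtain S where S: "S \<subseteq> N" "i \<in> S" "y = f S" by blast
      then have "S \<in> ?P" by blast
      then show "y \<in> E `` {f {i}}" using memE[OF i] S by auto
    qed
  qed
  have DE: "Domain E = (\<lambda>i. f {i}) ` N"
    by (force simp: E_def)
  \<comment> \<open>The letter \<open>f {i}\<close> is a successor of \<open>f {j}\<close> only if
    \<open>i = j\<close>, so the \<open>m\<close> successor sets differ.\<close>
  have "inj_on (\<lambda>i. f ` {S. S \<subseteq> N \<and> i \<in> S}) N"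
  proof (rule inj_onI)
    fix i j assume ij: "i \<in> N" "j \<in> N"
      and eq: "f ` {S. S \<subseteq> N \<and> i \<in> S} = f ` {S. S \<subseteq> N \<and> j \<in> S}"
    have "f {i} \<in> f ` {S. S \<subseteq> N \<and> j \<in> S}" unfolding eq[symmetric] using ij by auto
    then obtain S where "S \<subseteq> N" "j \<in> S" "f {i} = f S" by auto
    then show "i = j" using feq[of "{i}" S] ij by auto
  qed
  then have card1: "card ((\<lambda>x. E `` {x}) ` Domain E) = m"
    unfolding DE image_image
    by (subst image_cong[OF refl rows]) (simp_all add: card_image N_def)
  \<comment> \<open>Reversing \<open>L\<close> turns \<open>E\<close> into its converse, so the
    predecessor sets now count quotients; that of \<open>f S\<close> recovers
    \<open>S\<close>.\<close>
  have cols: "E\<inverse> `` {f S} = (\<lambda>i. f {i}) ` S" if "S \<in> ?P" for S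
  proof -
    have "y \<in> E\<inverse> `` {f S} \<longleftrightarrow> y \<in> (\<lambda>i. f {i}) ` S" for y
    proof
      assume y: "y \<in> E\<inverse> `` {f S}"
      then obtain T where "T \<in> ?P" "y = f T" using EP by blast
      then show "y \<in> (\<lambda>i. f {i}) ` S" using memE[of T S] that y by auto
    next
      assume "y \<in> (\<lambda>i. f {i}) ` S"
      then obtain i where "i \<in> S" "y = f {i}" by blast
      then show "y \<in> E\<inverse> `` {f S}" using memE[of "{i}" S] that by auto
    qed
    then show ?thesis by blast
  qed
  have DE': "Domain (E\<inverse>) = f ` ?P"
  proof
    show "f ` ?P \<subseteq> Domain (E\<inverse>)"
    proof (rule image_subsetI)
      fix S assume S: "S \<in> ?P"
      then obtain i where "i \<in> S" by blast
      then have "(f {i}, f S) \<in> E" using memE[of "{i}" S] S by auto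
      then show "f S \<in> Domain (E\<inverse>)" by blast
    qed
  qed (use EP in blast)
  have "inj_on (\<lambda>S. (\<lambda>i. f {i}) ` S) ?P"
  proof (rule inj_onI)
    fix S T assume *: "S \<in> ?P" "T \<in> ?P" "(\<lambda>i. f {i}) ` S = (\<lambda>i. f {i}) ` T"
    have "inj_on (\<lambda>i. f {i}) N" using feq by (auto intro!: inj_onI)
    then show "S = T" using * by (metis DiffD1 PowD inj_on_image_eq_iff)
  qed
  then have card2: "card ((\<lambda>x. E\<inverse> `` {x}) ` Domain (E\<inverse>)) = 2 ^ m - 1"
    unfolding DE' image_image using cP
    by (subst image_cong[OF refl cols]) (simp_all add: card_image)
  have revL: "rev ` L = (\<lambda>(x, y). [x, y]) ` (E\<inverse>)"
    by (force simp: L_def)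
  show ?thesis
  proof
    show "L \<subseteq> lists \<Sigma>" using ES by (auto simp: L_def)
    show "subword_free L" by (rule subword_free_length[of _ 2]) (auto simp: L_def)
    show "card (quotients \<Sigma> L) = m + 3"
      unfolding L_def using card_quotients_two_letter_words[OF ES nE finE] card1 by simp
    have "card (quotients \<Sigma> (rev ` L)) = 2 ^ m - 1 + 3"
      unfolding revL using card_quotients_two_letter_words[of "E\<inverse>" \<Sigma>] ES nE finE card2 by auto
    moreover have "(1::nat) \<le> 2 ^ m" by simp
    ultimately show "card (quotients \<Sigma> (rev ` L)) = 2 ^ m + 2" by linarith
  qed
qed

theorem theorem6:
  fixes \<Sigma> :: "'a set" and n :: nat
  assumes "finite \<Sigma>" and "\<Sigma> \<noteq> {}" and "n \<ge> 4"
  shows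
    "(\<forall>L. L \<subseteq> lists \<Sigma> \<and> subword_free L \<and> quotient_complexity \<Sigma> L = n \<longrightarrow>
        quotient_complexity \<Sigma> (rev ` L) \<le> 2 ^ (n - 3) + 2) \<and>
     (card \<Sigma> \<ge> 2 ^ (n - 3) - 1 \<longrightarrow>
        (\<exists>L. L \<subseteq> lists \<Sigma> \<and> subword_free L \<and> quotient_complexity \<Sigma> L = n \<and>
          quotient_complexity \<Sigma> (rev ` L) = 2 ^ (n - 3) + 2)) \<and>
     (card \<Sigma> < 2 ^ (n - 3) - 1 \<longrightarrow>
        (\<forall>L. L \<subseteq> lists \<Sigma> \<and> subword_free L \<and> quotient_complexity \<Sigma> L = n \<longrightarrow>
          quotient_complexity \<Sigma> (rev ` L) < 2 ^ (n - 3) + 2)) \<and>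
     (\<forall>L. L \<subseteq> lists \<Sigma> \<and> subword_free L \<and> quotient_complexity \<Sigma> L = n \<and>
        (\<exists>w\<in>L. length w \<ge> 3) \<longrightarrow>
        quotient_complexity \<Sigma> (rev ` L) < 2 ^ (n - 3) + 2)"
proof (intro conjI allI impI; (elim conjE)?)
  have loc: "subword_free_language \<Sigma> L"
    if "L \<subseteq> lists \<Sigma>" "subword_free L" "quotient_complexity \<Sigma> L = n" for L
    using that assms by unfold_locales (auto simp: quotient_complexity_def)
  {
    fix L assume L: "L \<subseteq> lists \<Sigma>" "subword_free L" "quotient_complexity \<Sigma> L = n"
    show "quotient_complexity \<Sigma> (rev ` L) \<le> 2 ^ (n - 3) + 2"
      using subword_free_language.card_quotients_rev_bound[OF loc[OF L]] L
      by (simp add: quotient_complexity_def)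
  next
    assume c: "2 ^ (n - 3) - 1 \<le> card \<Sigma>"
    \<comment> \<open>The condition \<open>n \<ge> 4\<close> makes the witness nonempty and keeps
      the truncated \<open>n - 3 + 3\<close> equal to \<open>n\<close>.\<close>
    have m: "1 \<le> n - 3" using assms by simp
    obtain L where "L \<subseteq> lists \<Sigma>" "subword_free L" "card (quotients \<Sigma> L) = n - 3 + 3"
      "card (quotients \<Sigma> (rev ` L)) = 2 ^ (n - 3) + 2"
      using bound_attained[OF assms(1) m c] by blast
    then show "\<exists>L. L \<subseteq> lists \<Sigma> \<and> subword_free L \<and> quotient_complexity \<Sigma> L = n \<and>
          quotient_complexity \<Sigma> (rev ` L) = 2 ^ (n - 3) + 2"
      using assms by (auto simp: quotient_complexity_def)
  next
    \<comment> \<open>The two strict inequalities are contrapositives: meeting the bound would force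
      enough letters, and words of length at most 2.\<close>
    fix L assume L: "L \<subseteq> lists \<Sigma>" "subword_free L" "quotient_complexity \<Sigma> L = n"
      and "card \<Sigma> < 2 ^ (n - 3) - 1"
    then show "quotient_complexity \<Sigma> (rev ` L) < 2 ^ (n - 3) + 2"
      using subword_free_language.card_alphabet_ge[OF loc[OF L]] assms
      by (force simp: quotient_complexity_def)
  next
    fix L assume L: "L \<subseteq> lists \<Sigma>" "subword_free L" "quotient_complexity \<Sigma> L = n"
      and "\<exists>w\<in>L. 3 \<le> length w"
    then show "quotient_complexity \<Sigma> (rev ` L) < 2 ^ (n - 3) + 2"
      using subword_free_language.length_le_2[OF loc[OF L]]
      by (force simp: quotient_complexity_def)
  }
qed

end
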